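(* For each $n\ge 6$ and each $1\le k\le\lfloor n/2\rfloor-1$, the polynomial $P^{n,k}(r)$ has a unique root in the interval $(1,2)$.
   Context: For an integer $n\ge 2$ let $N=\binom{n}{2}$. The edges $(i,j)$, $1\le i<j\le n$, of $K_n$ are ordered lexicographically $(1,2),(1,3),\dots,(1,n),(2,3),\dots,(n-1,n)$; $(i,j)$ has index $\mathrm{idx}(i,j)=(i-1)n-\binom{i}{2}+(j-i)$. For a binary string $\mathbf{x}=(x_1,\dots,x_n)$, the cut vector $\delta(\mathbf{x})\in\{0,1\}^N$ has entry $1$ at position $\mathrm{idx}(i,j)$ iff $x_i\ne x_j$. For $\delta\in\{0,1\}^N$ and a variable $r$, $W^n(\delta;r)=\sum_{i=1}^N\delta_i r^{N-i}$. For $1\le k\le n$, $C_k=\delta(1^k0^{n-k})$ ($k$ ones followed by $n-k$ zeros). For $1\le k\le n-1$, $P^{n,k}(r)=W^n(C_k;r)-W^n(C_{k+1};r)$. *)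

theory Defs
  imports "HOL-Computational_Algebra.Polynomial" Complex_Main
begin

(* For 1 <= i < j <= n no natural-number subtraction below truncates. *)
definition edge_idx :: "nat \<Rightarrow> nat \<Rightarrow> nat \<Rightarrow> nat" where
  "edge_idx n i j = ((i - 1) * n - (i choose 2)) + (j - i)"

(* The binary string x_1 ... x_n is the list x, so x_i is x ! (i - 1).
   Vectors of length N are functions on nat, of which only the values at 1, ..., N matter. *)
definition cut_vector :: "bool list \<Rightarrow> nat \<Rightarrow> nat" where
  "cut_vector x p = of_bool (\<exists>i j. 1 \<le> i \<and> i < j \<and> j \<le> length x \<and>
     p = edge_idx (length x) i j \<and> x ! (i - 1) \<noteq> x ! (j - 1))"

definition W_poly :: "nat \<Rightarrow> (nat \<Rightarrow> nat) \<Rightarrow> real poly" where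
  "W_poly n d = (\<Sum>i = 1..n choose 2. monom (of_nat (d i)) ((n choose 2) - i))"

definition C_cut :: "nat \<Rightarrow> nat \<Rightarrow> nat \<Rightarrow> nat" where
  "C_cut n k = cut_vector (replicate k True @ replicate (n - k) False)"

definition P_poly :: "nat \<Rightarrow> nat \<Rightarrow> real poly" where
  "P_poly n k = W_poly n (C_cut n k) - W_poly n (C_cut n (k + 1))"

end

(*
  The cuts C_k and C_{k+1} differ only in the edges meeting vertex k+1, so P^{n,k} is the sum of
  r^(N - idx(i,k+1)) over i <= k minus the sum of r^(N - idx(k+1,j)) over j >= k+2.  Every positive
  term has a larger exponent than every negative one, so P^{n,k} changes sign at most once on the
  positive axis.  It is negative at 1, where terms are merely counted, and positive at 2, where
  distinct powers 2^b with b < m add up to less than 2^m.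
*)
theory Submission
  imports Defs
begin

text \<open>Existence is the intermediate value theorem on [1, 2]. Uniqueness is shown among all
  positive zeros by comparing how the two sums grow when the argument is scaled, in place of
  Descartes' rule of signs.\<close>

lemma sum_powers_separated_unique_root:
  fixes A B :: "nat set"
  assumes "finite A" "finite B" "A \<noteq> {}" "card A < card B"
    and sep: "\<And>a b. a \<in> A \<Longrightarrow> b \<in> B \<Longrightarrow> b < a"
  shows "\<exists>!r :: real. r \<in> {1<..<2} \<and> (\<Sum>a\<in>A. r ^ a) - (\<Sum>b\<in>B. r ^ b) = 0"
proof -
  define m where "m = Min A"
  have mA: "m \<in> A" "\<And>a. a \<in> A \<Longrightarrow> m \<le> a"
    using assms(1,3) by (auto simp: m_def)
  have mB: "\<And>b. b \<in> B \<Longrightarrow> b < m"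
    using sep mA(1) by blast
  define f :: "real \<Rightarrow> real" where "f r = (\<Sum>a\<in>A. r ^ a) - (\<Sum>b\<in>B. r ^ b)" for r
  have f1: "f 1 < 0"
    using assms(4) by (simp add: f_def)
  have f2: "f 2 > 0"
  proof -
    have "(\<Sum>b\<in>B. (2::real) ^ b) \<le> (\<Sum>b<m. 2 ^ b)"
      using mB by (intro sum_mono2) auto
    also have "\<dots> < 2 ^ m"
      by (simp add: geometric_sum)
    also have "\<dots> \<le> (\<Sum>a\<in>A. (2::real) ^ a)"
      using assms(1) mA(1) by (intro member_le_sum) auto
    finally show ?thesis by (simp add: f_def)
  qed
  have "\<exists>r\<ge>1. r \<le> 2 \<and> f r = 0"
  proof (rule IVT')
    show "continuous_on {1..2} f"
      unfolding f_def by (intro continuous_intros)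
  qed (use f1 f2 in auto)
  then obtain r where "1 \<le> r" "r \<le> 2" "f r = 0" by blast
  then have ex: "r \<in> {1<..<2} \<and> f r = 0"
    using f1 f2 by (metis greaterThanLessThan_iff less_irrefl less_le)
  \<comment> \<open>Passing from \<open>s\<close> to \<open>t = q * s\<close> with
    \<open>q > 1\<close> multiplies each power in the \<open>B\<close>-sum by at most
    \<open>q ^ (m - 1)\<close> and each power in the \<open>A\<close>-sum by at least
    \<open>q ^ m\<close>. Sums that agree at \<open>s\<close> therefore cannot agree at
    \<open>t\<close>.\<close>
  have no_two: False if "0 < s" "s < t" "f s = 0" "f t = 0" for s t
  proof -
    define q where "q = t / s"
    have q: "q > 1" "t = q * s"
      using that by (auto simp: q_def)
    have Apos: "(\<Sum>a\<in>A. s ^ a) > 0"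
      using assms(1,3) that by (intro sum_pos) auto
    have "(\<Sum>b\<in>B. t ^ b) \<le> (\<Sum>b\<in>B. q ^ (m - 1) * s ^ b)"
      unfolding q(2) power_mult_distrib using q that
      by (intro sum_mono mult_right_mono power_increasing) (auto dest: mB)
    also have "\<dots> = q ^ (m - 1) * (\<Sum>a\<in>A. s ^ a)"
      using that(3) by (simp add: f_def sum_distrib_left)
    also have "\<dots> < q ^ m * (\<Sum>a\<in>A. s ^ a)"
    proof -
      \<comment> \<open>Subtraction truncates, so \<open>m > 0\<close> has to be known; any element
        of \<open>B\<close> lies below \<open>m\<close> and witnesses it.\<close>
      obtain b where "b \<in> B" using assms(4) by fastforce
      then have "m - 1 < m" using mB[of b] by simp
      then show ?thesis using q Apos by (intro mult_strict_right_mono power_strict_increasing)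
    qed
    also have "\<dots> \<le> (\<Sum>a\<in>A. t ^ a)"
      unfolding q(2) power_mult_distrib sum_distrib_left using q that
      by (intro sum_mono mult_right_mono power_increasing) (auto dest: mA(2))
    finally show False
      using that(4) by (simp add: f_def)
  qed
  have "r' = r" if "r' \<in> {1<..<2}" "f r' = 0" for r'
    using no_two[of r r'] no_two[of r' r] ex that by (cases r r' rule: linorder_cases) auto
  then show ?thesis
    using ex unfolding f_def by blast
qed

text \<open>Row \<open>a\<close> consists of the \<open>n - a\<close> edges (a, j) with a < j, so
  the sum counts the edges in the rows before row \<open>i\<close>. The additive form shows that the
  subtraction in \<open>edge_idx\<close> does not truncate.\<close>

lemma edge_row_offset:
  assumes "1 \<le> i" "i \<le> n"
  shows "(i - 1) * n = (i choose 2) + (\<Sum>a = 1..<i. n - a)"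
  using assms
proof (induction i rule: dec_induct)
  case base
  then show ?case by simp
next
  case (step i)
  have "Suc i choose 2 = (i choose 2) + i"
    by (simp add: numeral_2_eq_2)
  moreover have "(Suc i - 1) * n = (i - 1) * n + n"
    using step by (cases i) auto
  ultimately show ?case
    using step by simp
qed

lemma edge_idx_eq:
  assumes "1 \<le> i" "i \<le> n"
  shows "edge_idx n i j = (\<Sum>a = 1..<i. n - a) + (j - i)"
  using edge_row_offset[OF assms] by (simp add: edge_idx_def)

text \<open>This is \<open>edge_row_offset\<close> at i = n, where the left side is twice the
  binomial coefficient.\<close>

lemma choose_two_eq_sum:
  assumes "1 \<le> n"
  shows "n choose 2 = (\<Sum>a = 1..<n. n - a)"
proof -
  have "(n - 1) * n = 2 * (n choose 2)"
    by (cases n) (simp_all add: choose_two)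
  then show ?thesis
    using edge_row_offset[of n n] assms by simp
qed

text \<open>Row \<open>i\<close> ends where the offset of row i + 1 begins, and offsets grow with
  the row. Taking i' = n bounds every index by the number of edges; other i' separate distinct
  rows.\<close>

lemma edge_idx_le_row_end:
  assumes "1 \<le> i" "i < j" "j \<le> n" "i < i'"
  shows "edge_idx n i j \<le> (\<Sum>a = 1..<i'. n - a)"
proof -
  have "edge_idx n i j \<le> (\<Sum>a = 1..<Suc i. n - a)"
    using assms by (simp add: edge_idx_eq)
  also have "\<dots> \<le> (\<Sum>a = 1..<i'. n - a)"
    using assms by (intro sum_mono2) auto
  finally show ?thesis .
qed

lemma edge_idx_bounds:
  assumes "1 \<le> i" "i < j" "j \<le> n"
  shows "1 \<le> edge_idx n i j" "edge_idx n i j \<le> n choose 2"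
  using assms edge_idx_le_row_end[of i j n n] choose_two_eq_sum[of n]
  by (auto simp: edge_idx_eq)

lemma edge_idx_less:
  assumes "1 \<le> i" "i < j" "j \<le> n" "i < i'" "i' < j'" "j' \<le> n"
  shows "edge_idx n i j < edge_idx n i' j'"
  using edge_idx_le_row_end[of i j n i'] assms by (simp add: edge_idx_eq)

text \<open>Distinct rows are separated by \<open>edge_idx_less\<close>; within one row the index is
  a fixed offset plus j - i.\<close>

lemma edge_idx_inject:
  assumes "1 \<le> i" "i < j" "j \<le> n" "1 \<le> i'" "i' < j'" "j' \<le> n"
    and "edge_idx n i j = edge_idx n i' j'"
  shows "i = i' \<and> j = j'"
proof -
  have "i = i'"
    using edge_idx_less[of i j n i' j'] edge_idx_less[of i' j' n i j] assms
    by (cases i i' rule: linorder_cases) auto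
  then show ?thesis
    using assms by (simp add: edge_idx_eq)
qed

definition edge_exponent :: "nat \<Rightarrow> nat \<times> nat \<Rightarrow> nat" where
  "edge_exponent n = (\<lambda>(i, j). (n choose 2) - edge_idx n i j)"

lemma edge_exponent_less:
  assumes "1 \<le> i" "i < j" "j \<le> n" "i < i'" "i' < j'" "j' \<le> n"
  shows "edge_exponent n (i', j') < edge_exponent n (i, j)"
  using edge_idx_less[OF assms] edge_idx_bounds(2)[of i' j' n] assms
  by (simp add: edge_exponent_def diff_less_mono2)

lemma inj_on_edge_exponent:
  "inj_on (edge_exponent n) {(i, j). 1 \<le> i \<and> i < j \<and> j \<le> n}"
proof (rule inj_onI, clarsimp simp: edge_exponent_def)
  fix i j i' j'
  assume *: "Suc 0 \<le> i" "i < j" "j \<le> n" "Suc 0 \<le> i'" "i' < j'" "j' \<le> n"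
    "(n choose 2) - edge_idx n i j = (n choose 2) - edge_idx n i' j'"
  then have "edge_idx n i j = edge_idx n i' j'"
    using edge_idx_bounds(2)[of i j n] edge_idx_bounds(2)[of i' j' n] by simp
  then show "i = i' \<and> j = j'"
    using * edge_idx_inject[of i j n i' j'] by simp
qed

text \<open>In a block of ones followed by zeros, two entries at positions i < j differ only if the
  first is a one and the second a zero.\<close>

lemma C_cut_eq:
  assumes "k \<le> n"
  shows "C_cut n k p = of_bool (p \<in> (\<lambda>(i, j). edge_idx n i j) ` ({1..k} \<times> {k<..n}))"
proof -
  let ?x = "replicate k True @ replicate (n - k) False"
  have cut: "1 \<le> i \<and> i < j \<and> j \<le> n \<and> p = edge_idx n i j \<and> ?x ! (i - 1) \<noteq> ?x ! (j - 1) \<longleftrightarrow>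
      1 \<le> i \<and> i \<le> k \<and> k < j \<and> j \<le> n \<and> p = edge_idx n i j" for i j
  proof (cases "1 \<le> i \<and> i < j \<and> j \<le> n")
    case True
    then have "?x ! (i - 1) \<noteq> ?x ! (j - 1) \<longleftrightarrow> i \<le> k \<and> k < j"
      using assms by (auto simp: nth_append)
    then show ?thesis using True by blast
  next
    case False
    then show ?thesis by linarith
  qed
  have length: "length ?x = n"
    using assms by simp
  show ?thesis
    unfolding C_cut_def cut_vector_def length cut
    by (rule arg_cong[where f = of_bool]) (auto, blast)
qed

text \<open>Positions outside the image of the cut edges contribute zero, and the remaining ones can
  be reindexed by edges because \<open>edge_idx\<close> is injective on them.\<close>

lemma poly_W_C_cut:
  assumes "k \<le> n"
  shows "poly (W_poly n (C_cut n k)) r = (\<Sum>e\<in>{1..k} \<times> {k<..n}. r ^ edge_exponent n e)"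
proof -
  let ?E = "{1..k} \<times> {k<..n}" and ?idx = "\<lambda>(i, j). edge_idx n i j"
  have range: "?idx ` ?E \<subseteq> {1..n choose 2}"
    using edge_idx_bounds[of _ _ n] by fastforce
  have inj: "inj_on ?idx ?E"
    by (auto intro!: inj_onI dest!: edge_idx_inject[rotated -1])
  have "poly (W_poly n (C_cut n k)) r =
        (\<Sum>p = 1..n choose 2. of_bool (p \<in> ?idx ` ?E) * r ^ ((n choose 2) - p))"
    using C_cut_eq[OF assms] by (simp add: W_poly_def poly_sum poly_monom)
  also have "\<dots> = (\<Sum>p\<in>?idx ` ?E. r ^ ((n choose 2) - p))"
    using range by (intro sum.mono_neutral_cong_right) auto
  also have "\<dots> = (\<Sum>e\<in>?E. r ^ edge_exponent n e)"
    by (subst sum.reindex[OF inj]) (auto simp: edge_exponent_def intro!: sum.cong)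
  finally show ?thesis .
qed

text \<open>Edges from {1..k} to {k+2..n} are cut by both vectors and cancel; what remains are the
  edges at vertex k + 1.\<close>

lemma poly_P_poly:
  assumes "k < n"
  shows "poly (P_poly n k) r =
    (\<Sum>e\<in>{1..k} \<times> {k + 1}. r ^ edge_exponent n e) -
    (\<Sum>e\<in>{k + 1} \<times> {k + 1<..n}. r ^ edge_exponent n e)"
proof -
  have "{1..k} \<times> {k<..n} = {1..k} \<times> {k + 1<..n} \<union> {1..k} \<times> {k + 1}"
    "{1..k + 1} \<times> {k + 1<..n} = {1..k} \<times> {k + 1<..n} \<union> {k + 1} \<times> {k + 1<..n}"
    using assms by auto
  then have
    "(\<Sum>e\<in>{1..k} \<times> {k<..n}. r ^ edge_exponent n e) =
      (\<Sum>e\<in>{1..k} \<times> {k + 1<..n}. r ^ edge_exponent n e) +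
      (\<Sum>e\<in>{1..k} \<times> {k + 1}. r ^ edge_exponent n e)"
    "(\<Sum>e\<in>{1..k + 1} \<times> {k + 1<..n}. r ^ edge_exponent n e) =
      (\<Sum>e\<in>{1..k} \<times> {k + 1<..n}. r ^ edge_exponent n e) +
      (\<Sum>e\<in>{k + 1} \<times> {k + 1<..n}. r ^ edge_exponent n e)"
    by (simp_all only: finite_cartesian_product, (subst sum.union_disjoint; force)+)
  then show ?thesis
    using assms by (simp add: P_poly_def poly_W_C_cut)
qed

theorem mainTheorem7:
  fixes n k :: nat
  assumes "n \<ge> 6" and "1 \<le> k" and "k \<le> n div 2 - 1"
  shows "\<exists>!r :: real. r \<in> {1<..<2} \<and> poly (P_poly n k) r = 0"
proof -
  let ?A = "{1..k} \<times> {k + 1}" and ?B = "{k + 1} \<times> {k + 1<..n}"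
  \<comment> \<open>This makes the n - k - 1 edges from vertex k + 1 to later vertices outnumber the
    \<open>k\<close> edges to earlier ones.\<close>
  have kn: "2 * k + 2 \<le> n"
    using assms by linarith
  \<comment> \<open>Injectivity turns the sums over edges into sums over sets of exponents and
    preserves the number of terms.\<close>
  have inj: "inj_on (edge_exponent n) ?A" "inj_on (edge_exponent n) ?B"
    using kn by (auto intro: inj_on_subset[OF inj_on_edge_exponent])
  have "poly (P_poly n k) r =
      (\<Sum>a\<in>edge_exponent n ` ?A. r ^ a) - (\<Sum>b\<in>edge_exponent n ` ?B. r ^ b)" for r
    using kn by (simp only: poly_P_poly sum.reindex[OF inj(1)] sum.reindex[OF inj(2)] o_def)
  moreover have "\<exists>!r :: real. r \<in> {1<..<2} \<and>
      (\<Sum>a\<in>edge_exponent n ` ?A. r ^ a) - (\<Sum>b\<in>edge_exponent n ` ?B. r ^ b) = 0"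
  proof (rule sum_powers_separated_unique_root)
    show "card (edge_exponent n ` ?A) < card (edge_exponent n ` ?B)"
      unfolding card_image[OF inj(1)] card_image[OF inj(2)] using kn
      by (simp add: card_cartesian_product)
    show "b < a" if "a \<in> edge_exponent n ` ?A" "b \<in> edge_exponent n ` ?B" for a b
      using that kn by (auto intro!: edge_exponent_less)
  qed (use assms in auto)
  ultimately show ?thesis
    by simp
qed

end
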